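(* Let $X$ be a locally bounded order complete locally solid $f$-ring with unity and the Fatou property. If $\mathsf{Hom}^{b}_{nr}(X)$ has the Lebesgue property, then $X$ has the Lebesgue property.
   Context: An $\ell$-ring (lattice ring) is a ring which is also a lattice, the additive group being a lattice-ordered group, with $|x\cdot y|\le |x|\cdot|y|$ for all $x,y$. $X_+=\{x\in X: x\ge 0\}$. A set $S\subseteq X$ is solid if $x\in X$, $y\in S$, $|x|\le|y|$ imply $x\in S$. A locally solid $\ell$-ring is an $\ell$-ring that is also a topological ring and has a local basis at zero consisting of solid sets. An $f$-ring is an $\ell$-ring in which $a\wedge b=0$ and $c>0$ imply $ca\wedge b=ac\wedge b=0$; a locally solid $f$-ring is a locally solid $\ell$-ring that is an $f$-ring. Order complete: every non-empty subset that is bounded above has a supremum. A net $(x_\alpha)$ is order convergent to $x$ if there is a net $(z_\beta)$ (possibly over a different index set) with $z_\beta\downarrow 0$ such that for every $\beta$ there is $\alpha_0$ with $|x_\alpha-x|\le z_\beta$ for all $\alpha\ge\alpha_0$. A set is order closed if it contains the limits of all order convergent nets lying in it. $X$ has the Fatou property if its topology has a local basis at zero consisting of solid order closed neighborhoods. A locally solid $\ell$-ring has the Lebesgue property if every net with $u_\alpha\downarrow 0$ converges to $0$ topologically. A set $B$ in a topological ring is bounded if for each zero neighborhood $W$ there is a zero neighborhood $V$ with $VB\subseteq W$ and $BV\subseteq W$ (sets of products). $X$ is locally bounded if it has a bounded zero neighborhood. A group homomorphism $T:X\to X$ (of the additive group) is order bounded if it maps order bounded sets (sets contained in an order interval $[u,v]$)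 to order bounded sets, and $nr$-bounded if $T(U)$ is bounded for some zero neighborhood $U\subseteq X$. $\mathsf{Hom}^{b}_{nr}(X)$ is the set of all order bounded $nr$-bounded group homomorphisms $X\to X$, with pointwise addition, composition as multiplication, the order $T\le S$ iff $T(x)\le S(x)$ for all $x\in X_+$ (lattice operations given by Riesz–Kantorovich formulae, in particular $|T|(x)=\sup\{|T(u)|:|u|\le x\}$ for $x\in X_+$), and the topology of uniform convergence on some zero neighborhood: $(S_\alpha)$ converges to $S$ uniformly on a zero neighborhood $U\subseteq X$ if for each zero neighborhood $V\subseteq X$ there is $\alpha_0$ with $(S_\alpha-S)(U)\subseteq V$ for all $\alpha\ge\alpha_0$. It is a locally solid $\ell$-ring. Standing assumption: in every topological group considered (including the additive groups of topological rings), singletons are bounded in the group sense: for each $x$ and each neighborhood $U$ of the identity there is a positive integer $n$ with $x\in nU=\{x_1+\dots+x_n: x_i\in U\}$. *)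

theory Defs
  imports Complex_Main "HOL-Library.Lattice_Algebras"
begin

section \<open>Nets\<close>

text \<open>\<open>r i j\<close> reads: index \<open>j\<close> is later than index \<open>i\<close>.\<close>

definition net_on :: "'i set \<Rightarrow> ('i \<Rightarrow> 'i \<Rightarrow> bool) \<Rightarrow> bool" where
  "net_on I r \<longleftrightarrow>
     I \<noteq> {} \<and> (\<forall>i\<in>I. r i i) \<and>
     (\<forall>i\<in>I. \<forall>j\<in>I. \<forall>k\<in>I. r i j \<longrightarrow> r j k \<longrightarrow> r i k) \<and>
     (\<forall>i\<in>I. \<forall>j\<in>I. \<exists>k\<in>I. r i k \<and> r j k)"

definition net_filter :: "'i set \<Rightarrow> ('i \<Rightarrow> 'i \<Rightarrow> bool) \<Rightarrow> 'i filter" where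
  "net_filter I r = (INF i\<in>I. principal {j\<in>I. r i j})"

lemma eventually_net_filter:
  assumes "net_on I r"
  shows "eventually P (net_filter I r) \<longleftrightarrow> (\<exists>i\<in>I. \<forall>j\<in>I. r i j \<longrightarrow> P j)"
proof -
  have "\<exists>k\<in>I. principal {l\<in>I. r k l} \<le> inf (principal {l\<in>I. r i l}) (principal {l\<in>I. r j l})"
    if ij: "i \<in> I" "j \<in> I" for i j
  proof -
    obtain k where k: "k \<in> I" "r i k" "r j k"
      using assms ij unfolding net_on_def by blast
    have "{l\<in>I. r k l} \<subseteq> {l\<in>I. r i l} \<inter> {l\<in>I. r j l}"
      using assms ij k unfolding net_on_def by blast
    then show ?thesis using k(1) by auto
  qed
  moreover have "I \<noteq> {}" using assms by (simp add: net_on_def)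
  ultimately show ?thesis
    unfolding net_filter_def by (subst eventually_INF_base) (auto simp: eventually_principal)
qed

text \<open>The net \<open>u\<close> lies in \<open>C\<close>, is decreasing, and has infimum \<open>z\<close> in the ordered set \<open>(C, le)\<close>.\<close>

definition decreases_to ::
  "'b set \<Rightarrow> ('b \<Rightarrow> 'b \<Rightarrow> bool) \<Rightarrow> 'i set \<Rightarrow> ('i \<Rightarrow> 'i \<Rightarrow> bool) \<Rightarrow> ('i \<Rightarrow> 'b) \<Rightarrow> 'b \<Rightarrow> bool" where
  "decreases_to C le I r u z \<longleftrightarrow>
     (\<forall>i\<in>I. u i \<in> C) \<and>
     (\<forall>i\<in>I. \<forall>j\<in>I. r i j \<longrightarrow> le (u j) (u i)) \<and>
     z \<in> C \<and> (\<forall>i\<in>I. le z (u i)) \<and>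
     (\<forall>w\<in>C. (\<forall>i\<in>I. le w (u i)) \<longrightarrow> le w z)"

text \<open>Definitions below cannot quantify over types, so they quantify over nets whose index sets
  are arbitrary subsets of one fixed type. The lemmas ending in \<open>any_index\<close> show that this
  already covers nets over every index type: a decreasing net can be reindexed by its own range.\<close>

lemma decreases_to_range:
  assumes net: "net_on I r" and dec: "decreases_to C le I r u z"
    and refl: "reflp le" and trans: "transp le"
  shows "net_on (u ` I) (\<lambda>x y. le y x)"
    and "decreases_to C le (u ` I) (\<lambda>x y. le y x) (\<lambda>x. x) z"
proof -
  have "\<exists>k\<in>u ` I. le k (u i) \<and> le k (u j)" if ij: "i \<in> I" "j \<in> I" for i j
  proof -
    obtain k where "k \<in> I" "r i k" "r j k"
      using net ij unfolding net_on_def by blast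
    then show ?thesis using dec ij unfolding decreases_to_def by blast
  qed
  moreover have "I \<noteq> {}" using net by (simp add: net_on_def)
  ultimately show "net_on (u ` I) (\<lambda>x y. le y x)"
    unfolding net_on_def using reflpD[OF refl] by (auto intro: transpD[OF trans])
  show "decreases_to C le (u ` I) (\<lambda>x y. le y x) (\<lambda>x. x) z"
    using dec unfolding decreases_to_def by blast
qed

section \<open>Zero neighbourhoods\<close>

definition zero_nbhd :: "'a::{zero,topological_space} set \<Rightarrow> bool" where
  "zero_nbhd U \<longleftrightarrow> (\<exists>G. open G \<and> 0 \<in> G \<and> G \<subseteq> U)"

definition has_zero_basis :: "('a::{zero,topological_space} set \<Rightarrow> bool) \<Rightarrow> bool" where
  "has_zero_basis P \<longleftrightarrow>
     (\<exists>B. (\<forall>U\<in>B. zero_nbhd U \<and> P U) \<and> (\<forall>W. zero_nbhd W \<longrightarrow> (\<exists>U\<in>B. U \<subseteq> W)))"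

definition sumset :: "nat \<Rightarrow> 'a::comm_monoid_add set \<Rightarrow> 'a set" where
  "sumset n U = {(\<Sum>i<n. f i) | f. \<forall>i<n. f i \<in> U}"

definition singletons_bounded ::
  "'a::{comm_monoid_add,topological_space} itself \<Rightarrow> bool" where
  "singletons_bounded _ \<longleftrightarrow> (\<forall>(x::'a) U. zero_nbhd U \<longrightarrow> (\<exists>n>0. x \<in> sumset n U))"

section \<open>Lattice-ordered topological rings\<close>

text \<open>The class \<^class>\<open>lattice_ring\<close> demands that products of positive elements are positive;
  over a lattice-ordered additive group this is equivalent to \<open>\<bar>x * y\<bar> \<le> \<bar>x\<bar> * \<bar>y\<bar>\<close>. A ring
  topology is expressed by the classes \<^class>\<open>topological_ab_group_add\<close> and
  \<^class>\<open>topological_semigroup_mult\<close>. No separation axiom is assumed.\<close>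

lemma lattice_ring_condition:
  fixes a b :: "'a::{ring,lattice_ab_group_add_abs}"
  assumes "\<And>x y :: 'a. \<bar>x * y\<bar> \<le> \<bar>x\<bar> * \<bar>y\<bar>" and "0 \<le> a" "0 \<le> b"
  shows "0 \<le> a * b"
proof -
  have "0 \<le> \<bar>a * b\<bar>" by (rule abs_ge_zero)
  also have "\<dots> \<le> \<bar>a\<bar> * \<bar>b\<bar>" by (rule assms(1))
  finally show ?thesis using assms(2,3) by (simp add: abs_of_nonneg)
qed

definition solid :: "'a::lattice_ab_group_add_abs set \<Rightarrow> bool" where
  "solid S \<longleftrightarrow> (\<forall>x. \<forall>y\<in>S. \<bar>x\<bar> \<le> \<bar>y\<bar> \<longrightarrow> x \<in> S)"

definition locally_solid ::
  "'a::{lattice_ring,topological_ab_group_add,topological_semigroup_mult} itself \<Rightarrow> bool" where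
  "locally_solid _ \<longleftrightarrow> has_zero_basis (solid :: 'a set \<Rightarrow> bool)"

definition f_ring :: "'a::lattice_ring itself \<Rightarrow> bool" where
  "f_ring _ \<longleftrightarrow>
     (\<forall>a b c :: 'a. inf a b = 0 \<longrightarrow> 0 < c \<longrightarrow> inf (c * a) b = 0 \<and> inf (a * c) b = 0)"

definition order_complete :: "'a::lattice itself \<Rightarrow> bool" where
  "order_complete _ \<longleftrightarrow>
     (\<forall>A :: 'a set. A \<noteq> {} \<longrightarrow> bdd_above A \<longrightarrow>
        (\<exists>s. (\<forall>a\<in>A. a \<le> s) \<and> (\<forall>u. (\<forall>a\<in>A. a \<le> u) \<longrightarrow> s \<le> u)))"

definition order_convergent ::
  "'i set \<Rightarrow> ('i \<Rightarrow> 'i \<Rightarrow> bool) \<Rightarrow> ('i \<Rightarrow> 'a::lattice_ab_group_add_abs) \<Rightarrow> 'a \<Rightarrow> bool" where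
  "order_convergent I r x l \<longleftrightarrow>
     (\<exists>(J :: 'a set) s z. net_on J s \<and> decreases_to UNIV (\<le>) J s z 0 \<and>
        (\<forall>b\<in>J. \<forall>\<^sub>F i in net_filter I r. \<bar>x i - l\<bar> \<le> z b))"

lemma order_convergent_any_index:
  fixes J :: "'j set"
  assumes "net_on J s" "decreases_to UNIV (\<le>) J s z 0"
    and "\<forall>b\<in>J. \<forall>\<^sub>F i in net_filter I r. \<bar>x i - l\<bar> \<le> z b"
  shows "order_convergent I r x l"
proof -
  note range = decreases_to_range[OF assms(1,2) reflp_on_le transp_on_le]
  have "\<forall>b\<in>z ` J. \<forall>\<^sub>F i in net_filter I r. \<bar>x i - l\<bar> \<le> b"
    using assms(3) by blast
  with range show ?thesis
    unfolding order_convergent_def by blast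
qed

definition order_closed :: "'a::lattice_ab_group_add_abs set \<Rightarrow> bool" where
  "order_closed S \<longleftrightarrow>
     (\<forall>(I :: 'a set) r x l. net_on I r \<longrightarrow> (\<forall>i\<in>I. x i \<in> S) \<longrightarrow> order_convergent I r x l \<longrightarrow> l \<in> S)"

lemma order_closed_any_index:
  fixes I :: "'i set"
  assumes closed: "order_closed S" and net: "net_on I r"
    and S: "\<forall>i\<in>I. x i \<in> S" and conv: "order_convergent I r x l"
  shows "l \<in> S"
proof -
  obtain J :: "'a set" and s z where J: "net_on J s" "decreases_to UNIV (\<le>) J s z 0"
    and ev: "\<forall>b\<in>J. \<forall>\<^sub>F i in net_filter I r. \<bar>x i - l\<bar> \<le> z b"
    using conv unfolding order_convergent_def by (elim exE conjE) (rule that)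
  have "\<forall>b\<in>J. \<exists>i\<in>I. \<bar>x i - l\<bar> \<le> z b"
  proof
    fix b assume "b \<in> J"
    then have "\<forall>\<^sub>F i in net_filter I r. \<bar>x i - l\<bar> \<le> z b"
      by (rule bspec[OF ev])
    then obtain i where i: "i \<in> I" and le: "\<forall>j\<in>I. r i j \<longrightarrow> \<bar>x j - l\<bar> \<le> z b"
      by (auto simp: eventually_net_filter[OF net])
    have "r i i" using net i by (simp add: net_on_def)
    with i le show "\<exists>i\<in>I. \<bar>x i - l\<bar> \<le> z b" by auto
  qed
  then obtain h where h: "\<forall>b\<in>J. h b \<in> I \<and> \<bar>x (h b) - l\<bar> \<le> z b"
    by metis
  have "\<forall>\<^sub>F c in net_filter J s. \<bar>x (h c) - l\<bar> \<le> z b" if b: "b \<in> J" for b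
  proof -
    have "\<bar>x (h c) - l\<bar> \<le> z b" if "c \<in> J" "s b c" for c
    proof -
      have "z c \<le> z b" using J(2) b that unfolding decreases_to_def by blast
      with h that(1) show ?thesis using order_trans by blast
    qed
    then show ?thesis
      using b unfolding eventually_net_filter[OF J(1)] by blast
  qed
  then have "order_convergent J s (\<lambda>c. x (h c)) l"
    unfolding order_convergent_def using J by blast
  moreover have "x (h c) \<in> S" if "c \<in> J" for c using h S that by blast
  ultimately show ?thesis
    using closed[unfolded order_closed_def, rule_format, of J s "\<lambda>c. x (h c)" l] J(1) by blast
qed

definition fatou_property ::
  "'a::{lattice_ring,topological_ab_group_add,topological_semigroup_mult} itself \<Rightarrow> bool" where
  "fatou_property _ \<longleftrightarrow> has_zero_basis (\<lambda>U :: 'a set. solid U \<and> order_closed U)"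

definition lebesgue_property ::
  "'a::{lattice_ring,topological_ab_group_add,topological_semigroup_mult} itself \<Rightarrow> bool" where
  "lebesgue_property _ \<longleftrightarrow>
     (\<forall>(I :: 'a set) r (u :: 'a \<Rightarrow> 'a). net_on I r \<longrightarrow> decreases_to UNIV (\<le>) I r u 0 \<longrightarrow>
        (u \<longlongrightarrow> 0) (net_filter I r))"

lemma lebesgue_property_any_index:
  fixes u :: "'i \<Rightarrow> 'a::{lattice_ring,topological_ab_group_add,topological_semigroup_mult}"
  assumes leb: "lebesgue_property TYPE('a)"
    and net: "net_on I r" and dec: "decreases_to UNIV (\<le>) I r u 0"
  shows "(u \<longlongrightarrow> 0) (net_filter I r)"
proof (rule topological_tendstoI)
  fix G :: "'a set" assume G: "open G" "0 \<in> G"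
  note range = decreases_to_range[OF net dec reflp_on_le transp_on_le]
  have "((\<lambda>x. x) \<longlongrightarrow> 0) (net_filter (u ` I) (\<lambda>x y. y \<le> x))"
    using leb range unfolding lebesgue_property_def by blast
  then have "\<forall>\<^sub>F x in net_filter (u ` I) (\<lambda>x y. y \<le> x). x \<in> G"
    using G by (rule topological_tendstoD)
  then obtain i where "i \<in> I" "\<forall>j\<in>I. u j \<le> u i \<longrightarrow> u j \<in> G"
    unfolding eventually_net_filter[OF range(1)] by auto
  then show "\<forall>\<^sub>F i in net_filter I r. u i \<in> G"
    using dec unfolding eventually_net_filter[OF net] decreases_to_def by blast
qed

definition ring_bounded :: "'a::{zero,times,topological_space} set \<Rightarrow> bool" where
  "ring_bounded B \<longleftrightarrow>
     (\<forall>W. zero_nbhd W \<longrightarrow>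
        (\<exists>V. zero_nbhd V \<and> (\<forall>v\<in>V. \<forall>b\<in>B. v * b \<in> W) \<and> (\<forall>v\<in>V. \<forall>b\<in>B. b * v \<in> W)))"

definition locally_bounded :: "'a::{zero,times,topological_space} itself \<Rightarrow> bool" where
  "locally_bounded _ \<longleftrightarrow> (\<exists>U :: 'a set. zero_nbhd U \<and> ring_bounded U)"

section \<open>Order bounded nr-bounded homomorphisms\<close>

definition order_bounded :: "'a::order set \<Rightarrow> bool" where
  "order_bounded A \<longleftrightarrow> (\<exists>u v. A \<subseteq> {u..v})"

definition order_bounded_map :: "('a::order \<Rightarrow> 'a) \<Rightarrow> bool" where
  "order_bounded_map T \<longleftrightarrow> (\<forall>A. order_bounded A \<longrightarrow> order_bounded (T ` A))"

definition nr_bounded :: "('a::{zero,times,topological_space} \<Rightarrow> 'a) \<Rightarrow> bool" where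
  "nr_bounded T \<longleftrightarrow> (\<exists>U. zero_nbhd U \<and> ring_bounded (T ` U))"

definition Hom_nr_b ::
  "('a::{lattice_ring,topological_ab_group_add,topological_semigroup_mult} \<Rightarrow> 'a) set" where
  "Hom_nr_b = {T. additive T \<and> order_bounded_map T \<and> nr_bounded T}"

definition hom_le :: "('a::lattice_ring \<Rightarrow> 'a) \<Rightarrow> ('a \<Rightarrow> 'a) \<Rightarrow> bool" where
  "hom_le T S \<longleftrightarrow> (\<forall>x\<ge>0. T x \<le> S x)"

definition converges_uniformly_on ::
  "'a::{ab_group_add,topological_space} set \<Rightarrow> 'i set \<Rightarrow> ('i \<Rightarrow> 'i \<Rightarrow> bool) \<Rightarrow>
   ('i \<Rightarrow> 'a \<Rightarrow> 'a) \<Rightarrow> ('a \<Rightarrow> 'a) \<Rightarrow> bool" where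
  "converges_uniformly_on U I r T S \<longleftrightarrow>
     (\<forall>V. zero_nbhd V \<longrightarrow> (\<forall>\<^sub>F i in net_filter I r. (\<lambda>x. T i x - S x) ` U \<subseteq> V))"

text \<open>The neighbourhood \<open>U\<close> may depend on the net, but not on \<open>V\<close>. Topological convergence in
  \<open>Hom_nr_b\<close> means this convergence.\<close>

definition hom_converges ::
  "'i set \<Rightarrow> ('i \<Rightarrow> 'i \<Rightarrow> bool) \<Rightarrow>
   ('i \<Rightarrow> 'a \<Rightarrow> 'a) \<Rightarrow> ('a::{ab_group_add,topological_space} \<Rightarrow> 'a) \<Rightarrow> bool" where
  "hom_converges I r T S \<longleftrightarrow> (\<exists>U. zero_nbhd U \<and> converges_uniformly_on U I r T S)"

definition Hom_nr_b_lebesgue_property ::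
  "'a::{lattice_ring,topological_ab_group_add,topological_semigroup_mult} itself \<Rightarrow> bool" where
  "Hom_nr_b_lebesgue_property _ \<longleftrightarrow>
     (\<forall>(I :: ('a \<Rightarrow> 'a) set) r (T :: ('a \<Rightarrow> 'a) \<Rightarrow> ('a \<Rightarrow> 'a)).
        net_on I r \<longrightarrow> decreases_to Hom_nr_b hom_le I r T (\<lambda>x. 0) \<longrightarrow>
        hom_converges I r T (\<lambda>x. 0))"

lemma Hom_nr_b_lebesgue_property_any_index:
  fixes T ::
    "'i \<Rightarrow> 'a::{lattice_ring,topological_ab_group_add,topological_semigroup_mult} \<Rightarrow> 'a"
  assumes leb: "Hom_nr_b_lebesgue_property TYPE('a)"
    and net: "net_on I r" and dec: "decreases_to Hom_nr_b hom_le I r T (\<lambda>x. 0)"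
  shows "hom_converges I r T (\<lambda>x. 0)"
proof -
  have refl: "reflp (hom_le :: ('a \<Rightarrow> 'a) \<Rightarrow> _)"
    by (simp add: reflp_def hom_le_def)
  have trans: "transp (hom_le :: ('a \<Rightarrow> 'a) \<Rightarrow> _)"
    unfolding transp_def hom_le_def by (meson order_trans)
  note range = decreases_to_range[OF net dec refl trans]
  have "hom_converges (T ` I) (\<lambda>x y. hom_le y x) (\<lambda>x. x) (\<lambda>x. 0)"
    using leb range unfolding Hom_nr_b_lebesgue_property_def by blast
  then obtain U where U: "zero_nbhd U"
    and conv: "\<And>V. zero_nbhd V \<Longrightarrow>
      \<forall>\<^sub>F A in net_filter (T ` I) (\<lambda>x y. hom_le y x). (\<lambda>x. A x - 0) ` U \<subseteq> V"
    unfolding hom_converges_def converges_uniformly_on_def by blast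
  have "\<forall>\<^sub>F i in net_filter I r. (\<lambda>x. T i x - 0) ` U \<subseteq> V" if V: "zero_nbhd V" for V
  proof -
    obtain i where "i \<in> I" "\<forall>j\<in>I. hom_le (T j) (T i) \<longrightarrow> (\<lambda>x. T j x - 0) ` U \<subseteq> V"
      using conv[OF V] unfolding eventually_net_filter[OF range(1)] by blast
    then show ?thesis
      using dec unfolding eventually_net_filter[OF net] decreases_to_def by blast
  qed
  then show ?thesis
    using U unfolding hom_converges_def converges_uniformly_on_def by blast
qed

end

theory Submission
  imports Defs
begin

text \<open>
  The idea is to represent \<open>a \<ge> 0\<close> by the multiplication \<open>x \<mapsto> a * x\<close> and to read off convergence
  at the unity. Such a multiplication is monotone, hence order bounded, and it maps a bounded zero
  neighbourhood to a bounded set, so it lies in \<open>Hom_nr_b\<close> (\<open>mult_left_in_Hom_nr_b\<close>). If \<open>u\<^sub>i \<down> 0\<close>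
  in \<open>X\<close>, then the multiplications by \<open>u\<^sub>i\<close> decrease to the zero map; the Lebesgue property of
  \<open>Hom_nr_b\<close> then makes \<open>u\<^sub>i * x\<close> tend to \<open>0\<close> for every \<open>x\<close> in some zero neighbourhood \<open>U\<close>.
  Singletons being bounded, the unity is a finite sum of elements \<open>x\<^sub>k\<close> of \<open>U\<close>, so that
  \<open>u\<^sub>i = u\<^sub>i * x\<^sub>1 + \<dots> + u\<^sub>i * x\<^sub>n\<close> tends to \<open>0\<close> too.

  The step with content is that the infimum of the multiplications is zero, which amounts to the
  order continuity of multiplication by a fixed \<open>x \<ge> 0\<close> (\<open>mult_right_decreases_to_zero\<close>). For \<open>x\<close>
  below a multiple \<open>n\<close> of the unity it is the remark that \<open>n u\<^sub>i \<down> 0\<close>. A general \<open>x\<close> is cut off at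
  height \<open>n\<close>: the excess \<open>(x - n)\<^sup>+\<close> satisfies \<open>n (x - n)\<^sup>+ \<le> x\<^sup>2\<close> because the positive and negative
  parts of \<open>x - n\<close> have product zero in an \<open>f\<close>-ring (\<open>mult_excess_le_square\<close>). So a lower bound \<open>w\<close>
  of the \<open>u\<^sub>i * x\<close> satisfies \<open>n w \<le> u\<^sub>j * x\<^sup>2\<close> for all \<open>n\<close>, and is at most \<open>0\<close> because order
  completeness makes \<open>X\<close> Archimedean.

  The \<open>n\<close>-fold multiple of \<open>a\<close> is written as the sum of \<open>n\<close> copies of \<open>a\<close>, since the trivial ring is
  not excluded and the classes with a canonical map from the naturals require \<open>0 \<noteq> 1\<close>.
\<close>

text \<open>The supremum \<open>s\<close> of the multiples of \<open>a\<close> absorbs one more summand: \<open>s - a\<close> is again an upper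
  bound, whence \<open>s \<le> s - a\<close>.\<close>

lemma order_complete_imp_archimedean:
  fixes a b :: "'a::lattice_ab_group_add"
  assumes complete: "order_complete TYPE('a)"
    and bound: "\<And>n::nat. (\<Sum>k<n. a) \<le> b"
  shows "a \<le> 0"
proof -
  let ?A = "range (\<lambda>n::nat. \<Sum>k<n. a)"
  have "bdd_above ?A" "?A \<noteq> {}"
    using bound by (auto intro!: bdd_aboveI[of _ b])
  then have "\<exists>s. (\<forall>m\<in>?A. m \<le> s) \<and> (\<forall>v. (\<forall>m\<in>?A. m \<le> v) \<longrightarrow> s \<le> v)"
    using complete unfolding order_complete_def by blast
  then obtain s where upper: "\<And>n::nat. (\<Sum>k<n. a) \<le> s"
    and least: "\<And>v. (\<And>n::nat. (\<Sum>k<n. a) \<le> v) \<Longrightarrow> s \<le> v"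
    by blast
  have "(\<Sum>k<n. a) \<le> s - a" for n :: nat
    using upper[of "Suc n"] by (simp add: le_diff_eq)
  then have "s \<le> s - a" by (rule least)
  then show ?thesis by simp
qed

lemma multiples_decreasing_lower_bound:
  fixes u :: "'i \<Rightarrow> 'a::lattice_ab_group_add"
  assumes net: "net_on I r" and dec: "decreases_to UNIV (\<le>) I r u 0"
    and lower: "\<And>i. i \<in> I \<Longrightarrow> w \<le> (\<Sum>k<n::nat. u i)"
  shows "w \<le> 0"
  using lower
proof (induction n arbitrary: w)
  case 0
  then show ?case using net by (auto simp: net_on_def)
next
  case (Suc n)
  have "w \<le> u j" if j: "j \<in> I" for j
  proof -
    have "w - u j \<le> (\<Sum>k<n. u i)" if i: "i \<in> I" for i
    proof -
      \<comment> \<open>The summands may be evaluated at different indices, since a later index serves both.\<close>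
      obtain l where l: "l \<in> I" "r i l" "r j l"
        using net i j unfolding net_on_def by blast
      then have "u l \<le> u i" "u l \<le> u j"
        using dec i j unfolding decreases_to_def by blast+
      then have "(\<Sum>k<n. u l) + u l \<le> (\<Sum>k<n. u i) + u j"
        by (intro add_mono sum_mono)
      with Suc.prems[OF l(1)] show ?thesis
        by (simp add: diff_le_eq)
    qed
    then have "w - u j \<le> 0" by (rule Suc.IH)
    then show ?thesis by simp
  qed
  then show ?case using dec unfolding decreases_to_def by blast
qed

text \<open>Multiplying one factor at a time, disjointness of \<open>a\<close> and \<open>b\<close> passes to \<open>a * b\<close> and \<open>b\<close>, and
  then to \<open>a * b\<close> and itself.\<close>

lemma f_ring_disjoint_mult_eq_0:
  fixes a b :: "'a::lattice_ring"
  assumes f: "f_ring TYPE('a)" and disj: "inf a b = 0"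
  shows "a * b = 0"
proof (cases "a = 0 \<or> b = 0")
  case True
  then show ?thesis by auto
next
  case False
  have "0 \<le> a" "0 \<le> b" using disj by (metis inf_le1, metis inf_le2)
  with False have pos: "0 < a" "0 < b" by auto
  then have "inf (a * b) b = 0"
    using f disj unfolding f_ring_def by blast
  then have "inf b (a * b) = 0" by (simp add: inf_commute)
  then have "inf (a * b) (a * b) = 0"
    using f pos unfolding f_ring_def by blast
  then show ?thesis by simp
qed

lemma inf_pprt_uminus_nprt:
  fixes y :: "'a::lattice_ab_group_add"
  shows "inf (pprt y) (- nprt y) = 0"
proof -
  have "- nprt y = pprt y - y"
    using prts[of y] by (metis add_diff_cancel_left' minus_diff_eq)
  moreover have "inf (pprt y) (pprt y - y) = pprt y + inf 0 (- y)"
    by (simp add: add_inf_distrib_left)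
  moreover have "inf 0 (- y) = - pprt y"
    by (simp add: pprt_def neg_sup_eq_inf inf_commute)
  ultimately show ?thesis by simp
qed

lemma f_ring_nprt_mult_pprt:
  fixes y :: "'a::lattice_ring"
  assumes f: "f_ring TYPE('a)"
  shows "nprt y * pprt y = 0"
proof -
  have "- nprt y * pprt y = 0"
    by (rule f_ring_disjoint_mult_eq_0[OF f]) (simp add: inf_commute inf_pprt_uminus_nprt)
  then show ?thesis by simp
qed

text \<open>The negative part of the unity is nonnegative, because multiplying it by the unity leaves
  only its own square.\<close>

lemma f_ring_one_nonneg:
  assumes f: "f_ring TYPE('a::{lattice_ring,monoid_mult})"
  shows "(0::'a) \<le> 1"
proof -
  let ?p = "pprt (1::'a)" and ?q = "nprt (1::'a)"
  have "?q = ?q * (?p + ?q)" using prts[of "1::'a"] by (metis mult_1_right)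
  also have "\<dots> = ?q * ?q" by (simp add: distrib_left f_ring_nprt_mult_pprt[OF f])
  finally have "0 \<le> ?q" by (metis mult_nonpos_nonpos nprt_le_zero)
  also have "?q \<le> 1" by (simp add: nprt_def)
  finally show ?thesis .
qed

text \<open>The excess lives where \<open>e\<close> lies below \<open>x\<close>, so that \<open>x\<close> may replace \<open>e\<close> as its factor:
  multiplied by \<open>pprt (x - e)\<close>, the difference \<open>x - e\<close> becomes a square.\<close>

lemma mult_excess_le_square:
  fixes e x :: "'a::lattice_ring"
  assumes f: "f_ring TYPE('a)" and "0 \<le> e" "0 \<le> x"
  shows "e * pprt (x - e) \<le> x * x"
proof -
  let ?p = "pprt (x - e)"
  have "(x - e) * ?p = (?p + nprt (x - e)) * ?p" by (simp flip: prts)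
  also have "\<dots> = ?p * ?p" by (simp add: distrib_right f_ring_nprt_mult_pprt[OF f])
  finally have "0 \<le> (x - e) * ?p" by (simp add: mult_nonneg_nonneg)
  then have "e * ?p \<le> x * ?p" by (simp add: left_diff_distrib)
  also have "?p \<le> x" using assms by (simp add: pprt_def)
  then have "x * ?p \<le> x * x" using assms(3) by (rule mult_left_mono)
  finally show ?thesis .
qed

lemma mult_right_decreases_to_zero:
  fixes u :: "'i \<Rightarrow> 'a::{lattice_ring,monoid_mult}"
  assumes f: "f_ring TYPE('a)" and complete: "order_complete TYPE('a)"
    and net: "net_on I r" and dec: "decreases_to UNIV (\<le>) I r u 0"
    and x: "0 \<le> x"
  shows "decreases_to UNIV (\<le>) I r (\<lambda>i. u i * x) 0"
proof -
  have nonneg: "0 \<le> u i" if "i \<in> I" for i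
    using dec that unfolding decreases_to_def by blast
  have anti: "u j \<le> u i" if "i \<in> I" "j \<in> I" "r i j" for i j
    using dec that unfolding decreases_to_def by blast
  have "w \<le> 0" if w: "\<And>i. i \<in> I \<Longrightarrow> w \<le> u i * x" for w
  proof -
    obtain j where j: "j \<in> I" using net by (auto simp: net_on_def)
    have "(\<Sum>k<n. w) \<le> u j * (x * x)" for n :: nat
    proof -
      define e :: 'a where "e = (\<Sum>k<n. 1)"
      define p where "p = pprt (x - e)"
      have e: "0 \<le> e" unfolding e_def by (simp add: sum_nonneg f_ring_one_nonneg[OF f])
      have p: "0 \<le> p" unfolding p_def by simp
      have x_le: "x \<le> e + p"
        unfolding p_def pprt_def by (metis add.commute diff_le_eq sup_ge1)
      have "w - u j * p \<le> (\<Sum>k<n. u i)" if i: "i \<in> I" for i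
      proof -
        obtain l where l: "l \<in> I" "r i l" "r j l"
          using net i j unfolding net_on_def by blast
        have "w \<le> u l * (e + p)"
          using w[OF l(1)] mult_left_mono[OF x_le nonneg[OF l(1)]] by (rule order_trans)
        also have "\<dots> = u l * e + u l * p" by (rule distrib_left)
        also have "\<dots> \<le> u i * e + u j * p"
          using anti i j l e p by (intro add_mono mult_right_mono) auto
        also have "u i * e = (\<Sum>k<n. u i)"
          by (simp add: e_def sum_distrib_left)
        finally show ?thesis by (simp add: diff_le_eq)
      qed
      then have "w - u j * p \<le> 0"
        by (rule multiples_decreasing_lower_bound[OF net dec])
      then have "(\<Sum>k<n. w) \<le> (\<Sum>k<n. u j * p)"
        by (intro sum_mono) simp
      also have "\<dots> = u j * (e * p)"
        by (simp add: e_def sum_distrib_left sum_distrib_right)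
      also have "\<dots> \<le> u j * (x * x)"
        unfolding p_def by (intro mult_left_mono mult_excess_le_square f e x nonneg j)
      finally show ?thesis .
    qed
    then show "w \<le> 0" by (rule order_complete_imp_archimedean[OF complete])
  qed
  then show ?thesis
    unfolding decreases_to_def using nonneg anti x by (auto intro: mult_right_mono)
qed

text \<open>Boundedness constrains products on both sides. For \<open>v * (a * b)\<close> the neighbourhood is pulled
  back along right multiplication by \<open>a\<close>; for \<open>(a * b) * v\<close> the target is pulled back along left
  multiplication by \<open>a\<close>.\<close>

lemma ring_bounded_mult_left:
  fixes a :: "'a::{ring,topological_semigroup_mult}"
  assumes B: "ring_bounded B"
  shows "ring_bounded ((*) a ` B)"
  unfolding ring_bounded_def
proof (intro allI impI)
  have vimage: "zero_nbhd (h -` W)" if W: "zero_nbhd W" and h: "continuous_on UNIV h" "h 0 = 0"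
    for W and h :: "'a \<Rightarrow> 'a"
  proof -
    obtain G where G: "open G" "0 \<in> G" "G \<subseteq> W"
      using W unfolding zero_nbhd_def by blast
    then have "open (h -` G)" using h(1) by (simp add: open_vimage)
    with G h(2) show ?thesis
      unfolding zero_nbhd_def by (intro exI[of _ "h -` G"]) auto
  qed
  have left: "continuous_on UNIV (\<lambda>x::'a. a * x)" and right: "continuous_on UNIV (\<lambda>x::'a. x * a)"
    by (intro continuous_intros)+
  have bounded: "\<exists>V. zero_nbhd V \<and> (\<forall>v\<in>V. \<forall>b\<in>B. v * b \<in> W \<and> b * v \<in> W)"
    if "zero_nbhd W" for W
    using B that unfolding ring_bounded_def by meson
  fix W :: "'a set" assume W: "zero_nbhd W"
  obtain V where V: "zero_nbhd V" "\<forall>v\<in>V. \<forall>b\<in>B. v * b \<in> W"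
    using bounded[OF W] by auto
  obtain V' where V': "zero_nbhd V'" "\<forall>v\<in>V'. \<forall>b\<in>B. a * (b * v) \<in> W"
    using bounded[OF vimage[OF W left]] by auto
  let ?V = "(\<lambda>x. x * a) -` V \<inter> V'"
  have "zero_nbhd ((\<lambda>x. x * a) -` V)"
    using vimage[OF V(1) right] by simp
  then obtain G G' where "open G" "0 \<in> G" "G \<subseteq> (\<lambda>x. x * a) -` V" "open G'" "0 \<in> G'" "G' \<subseteq> V'"
    using V'(1) unfolding zero_nbhd_def by meson
  then have "zero_nbhd ?V"
    unfolding zero_nbhd_def by (intro exI[of _ "G \<inter> G'"]) (auto intro: open_Int)
  moreover have "v * (a * b) \<in> W" "(a * b) * v \<in> W" if "v \<in> ?V" "b \<in> B" for v b
    using that V(2) V'(2) by (auto simp: mult.assoc dest: bspec)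
  ultimately show "\<exists>V. zero_nbhd V \<and> (\<forall>v\<in>V. \<forall>b\<in>(*) a ` B. v * b \<in> W) \<and>
      (\<forall>v\<in>V. \<forall>b\<in>(*) a ` B. b * v \<in> W)"
    by (intro exI[of _ ?V]) auto
qed

lemma mult_left_in_Hom_nr_b:
  fixes a :: "'a::{lattice_ring,topological_ab_group_add,topological_semigroup_mult}"
  assumes bdd: "locally_bounded TYPE('a)" and a: "0 \<le> a"
  shows "(*) a \<in> Hom_nr_b"
proof -
  have "order_bounded ((*) a ` A)" if A: "order_bounded A" for A :: "'a set"
  proof -
    obtain s t where "A \<subseteq> {s..t}" using A unfolding order_bounded_def by blast
    then have "(*) a ` A \<subseteq> {a * s..a * t}" using a by (fastforce intro: mult_left_mono)
    then show ?thesis unfolding order_bounded_def by blast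
  qed
  moreover have "nr_bounded ((*) a)"
    using bdd ring_bounded_mult_left unfolding locally_bounded_def nr_bounded_def by blast
  ultimately show ?thesis
    unfolding Hom_nr_b_def order_bounded_map_def by (simp add: additive_def distrib_left)
qed

lemma mult_left_decreases_to_zero_map:
  fixes u :: "'i \<Rightarrow> 'a::{lattice_ring,topological_ab_group_add,topological_monoid_mult}"
  assumes f: "f_ring TYPE('a)" and complete: "order_complete TYPE('a)"
    and bdd: "locally_bounded TYPE('a)"
    and net: "net_on I r" and dec: "decreases_to UNIV (\<le>) I r u 0"
  shows "decreases_to Hom_nr_b hom_le I r (\<lambda>i. (*) (u i)) (\<lambda>x. 0)"
proof -
  have pointwise: "decreases_to UNIV (\<le>) I r (\<lambda>i. u i * x) 0" if "0 \<le> x" for x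
    using mult_right_decreases_to_zero[OF f complete net dec that] .
  have "(*) (u i) \<in> Hom_nr_b" if "i \<in> I" for i
    using mult_left_in_Hom_nr_b[OF bdd] dec that unfolding decreases_to_def by blast
  moreover have "(\<lambda>x. 0) \<in> (Hom_nr_b :: ('a \<Rightarrow> 'a) set)"
    using mult_left_in_Hom_nr_b[OF bdd order_refl] unfolding mult_zero_left .
  ultimately show ?thesis
    using pointwise unfolding decreases_to_def hom_le_def by blast
qed

lemma hom_converges_imp_pointwise:
  fixes T :: "'i \<Rightarrow> 'b::{ab_group_add,topological_space} \<Rightarrow> 'b"
  assumes "hom_converges I r T (\<lambda>x. 0)"
  obtains U where "zero_nbhd U" "\<And>x. x \<in> U \<Longrightarrow> ((\<lambda>i. T i x) \<longlongrightarrow> 0) (net_filter I r)"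
proof -
  obtain U where U: "zero_nbhd U"
    and conv: "\<And>V. zero_nbhd V \<Longrightarrow> \<forall>\<^sub>F i in net_filter I r. (\<lambda>x. T i x - 0) ` U \<subseteq> V"
    using assms unfolding hom_converges_def converges_uniformly_on_def by blast
  have "((\<lambda>i. T i x) \<longlongrightarrow> 0) (net_filter I r)" if "x \<in> U" for x
  proof (rule topological_tendstoI)
    fix G :: "'b set" assume "open G" "0 \<in> G"
    then have "zero_nbhd G" unfolding zero_nbhd_def by blast
    from conv[OF this] show "\<forall>\<^sub>F i in net_filter I r. T i x \<in> G"
      by (rule eventually_mono) (use that in auto)
  qed
  with U show ?thesis by (rule that)
qed

theorem corollary9:
  assumes "singletons_bounded
      TYPE('a::{lattice_ring,topological_ab_group_add,topological_monoid_mult})"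
    and "locally_solid TYPE('a)"
    and "f_ring TYPE('a)"
    and "locally_bounded TYPE('a)"
    and "order_complete TYPE('a)"
    and "fatou_property TYPE('a)"
    and "Hom_nr_b_lebesgue_property TYPE('a)"
  shows "lebesgue_property TYPE('a)"
  unfolding lebesgue_property_def
proof (intro allI impI)
  fix I :: "'a set" and r and u :: "'a \<Rightarrow> 'a"
  assume net: "net_on I r" and dec: "decreases_to UNIV (\<le>) I r u 0"
  have "hom_converges I r (\<lambda>i. (*) (u i)) (\<lambda>x. 0)"
    by (rule Hom_nr_b_lebesgue_property_any_index[OF assms(7) net
          mult_left_decreases_to_zero_map[OF assms(3,5,4) net dec]])
  then obtain U where U: "zero_nbhd U"
    and conv: "\<And>x. x \<in> U \<Longrightarrow> ((\<lambda>i. u i * x) \<longlongrightarrow> 0) (net_filter I r)"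
    by (rule hom_converges_imp_pointwise) blast
  obtain n where "(1::'a) \<in> sumset n U"
    using assms(1) U unfolding singletons_bounded_def by blast
  then obtain x where x: "\<And>k. k < n \<Longrightarrow> x k \<in> U" and one: "1 = (\<Sum>k<n. x k)"
    unfolding sumset_def by blast
  have "((\<lambda>i. \<Sum>k<n. u i * x k) \<longlongrightarrow> (\<Sum>k<n. 0)) (net_filter I r)"
    by (intro tendsto_sum conv x) simp
  moreover have "(\<Sum>k<n. u i * x k) = u i" for i
    by (simp flip: sum_distrib_left one)
  ultimately show "(u \<longlongrightarrow> 0) (net_filter I r)" by simp
qed

end
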